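(* Let $m_{00},m_{11},m_{22},m_{33}\ge0$ with $\sum_im_{ii}=1$ and $e_p\in[0,1]$ be the values obtained in parameter estimation in the BB84 protocol, let $e_b=m_{11}+m_{22}$, and let $\mathcal{S}$ be the (nonempty) set of all two-qubit states $\rho_{AB}$ whose diagonal elements in the ordered basis $|00\rangle,|01\rangle,|10\rangle,|11\rangle$ are $m_{00},m_{11},m_{22},m_{33}$ and which satisfy $\mathrm{Tr}(\Pi_x^-\rho_{AB})=e_p$. Let $(\bar a,\bar b)$ be a solution of the problem: minimize $C(\rho(a,b))$ over $a,b\in\mathbb{R}$ subject to $a+b=\tfrac12-e_p$, $|a|\le\sqrt{m_{00}m_{33}}$, $|b|\le\sqrt{m_{11}m_{22}}$, where $$\rho(a,b)=\begin{pmatrix}m_{00}&0&0&a\\ 0&m_{11}&b&0\\ 0&b&m_{22}&0\\ a&0&0&m_{33}\end{pmatrix}.$$ Then, in the symmetric case, the secret key rate $K$ of the BB84 QKD protocol satisfies $$K=\min_{\rho_{AB}\in\mathcal{S}}C(\Phi(\rho_{AB}))-H(e_b)=K_{BB84}^{opt},\qquad K_{BB84}^{opt}:=C(\rho(\bar a,\bar b))-H(e_b).$$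
   Context: States are density operators on $\mathbb{C}^2\otimes\mathbb{C}^2$; logarithms are base 2; $S(\rho)=-\mathrm{Tr}[\rho\log_2\rho]$; $H(e)=-e\log_2e-(1-e)\log_2(1-e)$. $|\pm\rangle=(|0\rangle\pm|1\rangle)/\sqrt2$. $\Pi^+=|00\rangle\langle00|+|11\rangle\langle11|$, $\Pi^-=|01\rangle\langle01|+|10\rangle\langle10|$, $\Pi_x^-=|{+-}\rangle\langle{+-}|+|{-+}\rangle\langle{-+}|$. $\Phi(\rho)=\Pi^+\rho\,\Pi^++\Pi^-\rho\,\Pi^-$. $C(\rho)=S(\rho^{\mathrm{diag}})-S(\rho)$ is the relative entropy of coherence in the reference basis $\{|00\rangle,|01\rangle,|10\rangle,|11\rangle\}$, with $\rho^{\mathrm{diag}}$ the diagonal part of $\rho$ in that basis. Key rate. Alice and Bob share i.i.d. copies of an unknown $\rho_{AB}\in\mathcal{S}$ (collective attacks, asymptotic limit) and generate key by measuring in the $Z$ basis $\{|0\rangle,|1\rangle\}$. In the symmetric case the reconciliation cost is taken to be $H(e_b)$. For a state $\rho$ of $Q=AB$ with purification $|\psi\rangle_{QE}$, let $R(\rho)=S(Q|E)$ be the conditional entropy of the state $\sum_i|i\rangle\langle i|_Q\otimes\langle i|_Q|\psi\rangle\langle\psi|_{QE}|i\rangle_Q$ obtained by measuring $Q$ in the reference basis. With $\rho_{AB}^{\pm}=\Pi^{\pm}\rho_{AB}\Pi^{\pm}/\mathrm{Tr}(\Pi^{\pm}\rho_{AB})$ (terms of zero weight omitted) and $\sigma_x^B$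 the bit flip on Bob's qubit, the key rate is $K=\min_{\rho_{AB}\in\mathcal{S}}\left[(1-e_b)R(\rho_{AB}^+)+e_bR(\sigma_x^B\rho_{AB}^-\sigma_x^B)\right]-H(e_b)$. *)

theory Defs
  imports "HOL-Analysis.Analysis"
begin

type_synonym 'n ket = "(complex, 'n) vec"
type_synonym 'n operator = "((complex, 'n) vec, 'n) vec"

definition ket :: "'n \<Rightarrow> ('n::finite) ket" where
  "ket i = axis i 1"

definition ketbra :: "('n::finite) ket \<Rightarrow> 'n ket \<Rightarrow> 'n operator" where
  "ketbra v w = (\<chi> i j. v $ i * cnj (w $ j))"

abbreviation proj :: "('n::finite) ket \<Rightarrow> 'n operator" where
  "proj v \<equiv> ketbra v v"

definition dagger :: "('n::finite) operator \<Rightarrow> 'n operator" where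
  "dagger A = (\<chi> i j. cnj (A $ j $ i))"

definition is_unitary :: "('n::finite) operator \<Rightarrow> bool" where
  "is_unitary U \<longleftrightarrow> U ** dagger U = mat 1 \<and> dagger U ** U = mat 1"

definition diag_op :: "('n::finite \<Rightarrow> real) \<Rightarrow> 'n operator" where
  "diag_op d = (\<chi> i j. if i = j then of_real (d i) else 0)"

definition is_density :: "('n::finite) operator \<Rightarrow> bool" where
  "is_density \<rho> \<longleftrightarrow> dagger \<rho> = \<rho>
     \<and> (\<forall>v. 0 \<le> Re (\<Sum>i\<in>UNIV. cnj (v $ i) * (\<rho> *v v) $ i))
     \<and> trace \<rho> = 1"

text \<open>Functional calculus for Hermitian operators: \<open>f\<close> is applied to the eigenvalues in a
  spectral decomposition. The result does not depend on the decomposition (see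
  \<open>fun_op_unique\<close>).\<close>

definition fun_op :: "(real \<Rightarrow> real) \<Rightarrow> ('n::finite) operator \<Rightarrow> 'n operator" where
  "fun_op f A = (THE B. \<exists>U d. is_unitary U \<and> A = U ** diag_op d ** dagger U
                            \<and> B = U ** diag_op (f \<circ> d) ** dagger U)"

lemma diag_op_mult: "(diag_op d ** W) $ i $ j = of_real (d i) * W $ i $ j"
proof -
  have "(diag_op d ** W) $ i $ j = (\<Sum>k\<in>UNIV. (if i = k then of_real (d i) * W $ k $ j else 0))"
    by (simp add: diag_op_def matrix_matrix_mult_def if_distrib [of "\<lambda>x. x * _"] cong: if_cong)
  then show ?thesis by simp
qed

lemma mult_diag_op: "(W ** diag_op d) $ i $ j = W $ i $ j * of_real (d j)"
proof -
  have "(W ** diag_op d) $ i $ j = (\<Sum>k\<in>UNIV. (if k = j then W $ i $ k * of_real (d k) else 0))"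
    by (simp add: diag_op_def matrix_matrix_mult_def if_distrib [of "\<lambda>x. _ * x"] cong: if_cong)
  then show ?thesis by simp
qed

lemma fun_op_unique:
  assumes U: "is_unitary U" and V: "is_unitary V"
    and eq: "U ** diag_op d ** dagger U = V ** diag_op e ** dagger V"
  shows "U ** diag_op (f \<circ> d) ** dagger U = V ** diag_op (f \<circ> e) ** dagger V"
proof -
  define W where "W = dagger V ** U"
  have UU: "dagger U ** U = mat 1" and VV: "dagger V ** V = mat 1" "V ** dagger V = mat 1"
    and UU': "U ** dagger U = mat 1"
    using U V by (auto simp: is_unitary_def)
  have "W ** diag_op d = dagger V ** (U ** diag_op d ** dagger U) ** U"
    by (simp add: W_def matrix_mul_assoc [symmetric] UU)
  also have "\<dots> = (dagger V ** V) ** diag_op e ** W"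
    by (simp add: eq W_def matrix_mul_assoc)
  finally have "W ** diag_op d = diag_op e ** W"
    by (simp add: VV)
  then have "W $ i $ j * of_real (d j) = of_real (e i) * W $ i $ j" for i j
    by (metis diag_op_mult mult_diag_op)
  then have "W $ i $ j = 0 \<or> d j = e i" for i j
    by (metis mult.commute mult_left_cancel of_real_eq_iff)
  then have "(W ** diag_op (f \<circ> d)) $ i $ j = (diag_op (f \<circ> e) ** W) $ i $ j" for i j
    unfolding diag_op_mult mult_diag_op by (metis comp_apply mult.commute mult_zero_left)
  then have *: "W ** diag_op (f \<circ> d) = diag_op (f \<circ> e) ** W"
    by (simp add: vec_eq_iff)
  have "U ** diag_op (f \<circ> d) ** dagger U = V ** (W ** diag_op (f \<circ> d)) ** dagger U"
    by (simp add: W_def matrix_mul_assoc VV)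
  also have "\<dots> = V ** diag_op (f \<circ> e) ** dagger V ** (U ** dagger U)"
    by (simp only: * ) (simp add: W_def matrix_mul_assoc)
  finally show ?thesis
    by (simp add: UU')
qed

text \<open>The value of \<open>log 2\<close> at \<open>0\<close> is irrelevant below: on the kernel of \<open>\<rho>\<close> it is
  multiplied by the eigenvalue \<open>0\<close>, which gives the convention \<open>0 log 0 = 0\<close>.\<close>

definition entropy :: "('n::finite) operator \<Rightarrow> real" where
  "entropy \<rho> = - Re (trace (\<rho> ** fun_op (log 2) \<rho>))"

definition binary_entropy :: "real \<Rightarrow> real" where
  "binary_entropy e = - e * log 2 e - (1 - e) * log 2 (1 - e)"

definition diag_part :: "('n::finite) operator \<Rightarrow> 'n operator" where
  "diag_part \<rho> = (\<chi> i j. if i = j then \<rho> $ i $ j else 0)"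

definition coherence :: "('n::finite) operator \<Rightarrow> real" where
  "coherence \<rho> = entropy (diag_part \<rho>) - entropy \<rho>"

definition tensor_ket :: "('n::finite) ket \<Rightarrow> ('m::finite) ket \<Rightarrow> ('n \<times> 'm) ket" where
  "tensor_ket v w = (\<chi> p. v $ fst p * w $ snd p)"

definition tensor_op :: "('n::finite) operator \<Rightarrow> ('m::finite) operator \<Rightarrow> ('n \<times> 'm) operator" where
  "tensor_op A B = (\<chi> p q. A $ fst p $ fst q * B $ snd p $ snd q)"

definition ptrace_fst :: "('q::finite \<times> 'e::finite) operator \<Rightarrow> 'e operator" where
  "ptrace_fst M = (\<chi> e e'. \<Sum>q\<in>UNIV. M $ (q, e) $ (q, e'))"

definition ptrace_snd :: "('q::finite \<times> 'e::finite) operator \<Rightarrow> 'q operator" where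
  "ptrace_snd M = (\<chi> q q'. \<Sum>e\<in>UNIV. M $ (q, e) $ (q', e))"

definition cond_entropy :: "('q::finite \<times> 'e::finite) operator \<Rightarrow> real" where
  "cond_entropy M = entropy M - entropy (ptrace_fst M)"

definition purifies :: "('q::finite \<times> 'e::finite) ket \<Rightarrow> 'q operator \<Rightarrow> bool" where
  "purifies \<psi> \<rho> \<longleftrightarrow> ptrace_snd (proj \<psi>) = \<rho>"

text \<open>\<open>block_op M i\<close> is the operator \<open>\<langle>i| M |i\<rangle>\<close> on the second factor, for the basis
  state \<open>|i\<rangle>\<close> of the first factor.\<close>

definition block_op :: "('q::finite \<times> 'e::finite) operator \<Rightarrow> 'q \<Rightarrow> 'e operator" where
  "block_op M i = (\<chi> e e'. M $ (i, e) $ (i, e'))"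

definition measured_state :: "('q::finite \<times> 'e::finite) ket \<Rightarrow> ('q \<times> 'e) operator" where
  "measured_state \<psi> = (\<Sum>i\<in>UNIV. tensor_op (proj (ket i)) (block_op (proj \<psi>) i))"

text \<open>A purification has to be picked in order to evaluate \<open>R(\<rho>)\<close>; \<open>pur\<close> is the function
  that picks it.\<close>

definition randomness :: "(('q::finite) operator \<Rightarrow> ('q \<times> 'e::finite) ket) \<Rightarrow> 'q operator \<Rightarrow> real" where
  "randomness pur \<rho> = cond_entropy (measured_state (pur \<rho>))"

text \<open>Qubit basis states are indexed by \<open>0\<close>, \<open>1\<close> of the two-element type \<open>2\<close>
  (where the numeral \<open>2\<close> equals \<open>0\<close>). The basis state \<open>|ij\<rangle>\<close> of Alice's and Bob's
  qubits is \<open>ket (i, j)\<close>.\<close>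

type_synonym two_qubit_op = "(2 \<times> 2) operator"

definition ket_plus :: "2 ket" where
  "ket_plus = (1 / sqrt 2) *\<^sub>R (ket 0 + ket 1)"

definition ket_minus :: "2 ket" where
  "ket_minus = (1 / sqrt 2) *\<^sub>R (ket 0 - ket 1)"

definition Pi_plus :: two_qubit_op where
  "Pi_plus = proj (ket (0, 0)) + proj (ket (1, 1))"

definition Pi_minus :: two_qubit_op where
  "Pi_minus = proj (ket (0, 1)) + proj (ket (1, 0))"

definition Pi_x_minus :: two_qubit_op where
  "Pi_x_minus = proj (tensor_ket ket_plus ket_minus) + proj (tensor_ket ket_minus ket_plus)"

definition Phi :: "two_qubit_op \<Rightarrow> two_qubit_op" where
  "Phi \<rho> = Pi_plus ** \<rho> ** Pi_plus + Pi_minus ** \<rho> ** Pi_minus"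

definition bit_flip_B :: two_qubit_op where
  "bit_flip_B = tensor_op (mat 1) (ketbra (ket 0) (ket 1) + ketbra (ket 1) (ket 0))"

definition post_state :: "two_qubit_op \<Rightarrow> two_qubit_op \<Rightarrow> two_qubit_op" where
  "post_state P \<rho> = (1 / Re (trace (P ** \<rho>))) *\<^sub>R (P ** \<rho> ** P)"

definition bb84_states :: "real \<Rightarrow> real \<Rightarrow> real \<Rightarrow> real \<Rightarrow> real \<Rightarrow> two_qubit_op set" where
  "bb84_states m00 m11 m22 m33 ep =
    {\<rho>. is_density \<rho>
       \<and> \<rho> $ (0, 0) $ (0, 0) = of_real m00 \<and> \<rho> $ (0, 1) $ (0, 1) = of_real m11
       \<and> \<rho> $ (1, 0) $ (1, 0) = of_real m22 \<and> \<rho> $ (1, 1) $ (1, 1) = of_real m33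
       \<and> trace (Pi_x_minus ** \<rho>) = of_real ep}"

definition secret_randomness ::
    "(two_qubit_op \<Rightarrow> ((2 \<times> 2) \<times> 'e::finite) ket) \<Rightarrow> real \<Rightarrow> two_qubit_op \<Rightarrow> real" where
  "secret_randomness pur eb \<rho> =
     (if 1 - eb = 0 then 0 else (1 - eb) * randomness pur (post_state Pi_plus \<rho>))
     + (if eb = 0 then 0
        else eb * randomness pur (bit_flip_B ** post_state Pi_minus \<rho> ** bit_flip_B))"

text \<open>The value is the minimum only when the minimum is attained; attainment has to be stated
  separately.\<close>

definition min_over :: "('a \<Rightarrow> real) \<Rightarrow> 'a set \<Rightarrow> real" where
  "min_over f S = (LEAST y. y \<in> f ` S)"

definition key_rate ::
    "(two_qubit_op \<Rightarrow> ((2 \<times> 2) \<times> 'e::finite) ket) \<Rightarrow> real \<Rightarrow> two_qubit_op set \<Rightarrow> real" where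
  "key_rate pur eb S = min_over (secret_randomness pur eb) S - binary_entropy eb"

definition rho_ab :: "real \<Rightarrow> real \<Rightarrow> real \<Rightarrow> real \<Rightarrow> real \<Rightarrow> real \<Rightarrow> two_qubit_op" where
  "rho_ab m00 m11 m22 m33 a b =
     m00 *\<^sub>R proj (ket (0, 0)) + m11 *\<^sub>R proj (ket (0, 1))
     + m22 *\<^sub>R proj (ket (1, 0)) + m33 *\<^sub>R proj (ket (1, 1))
     + a *\<^sub>R (ketbra (ket (0, 0)) (ket (1, 1)) + ketbra (ket (1, 1)) (ket (0, 0)))
     + b *\<^sub>R (ketbra (ket (0, 1)) (ket (1, 0)) + ketbra (ket (1, 0)) (ket (0, 1)))"

end

theory Submission
  imports Defs
begin

text \<open>For a pure state on \<open>QE\<close>, measuring \<open>Q\<close> in the reference basis gives a mixture of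
  orthogonal pure states of weights \<open>\<rho>\<^sub>i\<^sub>i\<close> without changing the marginal on \<open>E\<close>, whose entropy is
  \<open>S(\<rho>)\<close>; hence \<open>R(\<rho>) = C(\<rho>)\<close>. The state \<open>\<Phi>(\<rho>)\<close> consists of two Hermitian \<open>2 \<times> 2\<close> blocks with
  diagonals \<open>(m\<^sub>0\<^sub>0, m\<^sub>3\<^sub>3)\<close>, \<open>(m\<^sub>1\<^sub>1, m\<^sub>2\<^sub>2)\<close> and off-diagonal entries \<open>z\<close>, \<open>w\<close>. Coherence is additive over
  the blocks and homogeneous under scaling of a block, so the weighted randomness of the two
  post-measurement states is \<open>C(\<Phi>(\<rho>))\<close>. The coherence of a block is nondecreasing in the
  modulus of the off-diagonal entry, while the phase error rate only fixes \<open>Re z + Re w\<close>;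
  replacing \<open>z\<close>, \<open>w\<close> by their real parts therefore stays in the feasible set and does not
  increase the coherence.\<close>

section \<open>Orthonormal systems and entropy\<close>

text \<open>Conjugate-linear in the second argument, so that the entries of a matrix times its
  adjoint are the inner products of its rows.\<close>

definition cinner :: "('n::finite) ket \<Rightarrow> 'n ket \<Rightarrow> complex" where
  "cinner v w = (\<Sum>k\<in>UNIV. v $ k * cnj (w $ k))"

definition orthonormal :: "('n::finite) ket set \<Rightarrow> bool" where
  "orthonormal B \<longleftrightarrow> (\<forall>v\<in>B. \<forall>w\<in>B. cinner v w = (if v = w then 1 else 0))"

lemma cinner_diff_left: "cinner (u - v) w = cinner u w - cinner v w"
  by (simp add: cinner_def algebra_simps sum_subtractf)

lemma cinner_sum_left: "cinner (\<Sum>i\<in>I. c i *s v i) w = (\<Sum>i\<in>I. c i * cinner (v i) w)"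
proof (induction I rule: infinite_finite_induct)
  case (insert i I)
  then show ?case
    by (simp add: cinner_def algebra_simps sum.distrib sum_distrib_left)
qed (simp_all add: cinner_def)

lemma cinner_scaleR: "cinner (a *\<^sub>R v) (b *\<^sub>R w) = of_real (a * b) * cinner v w"
  by (simp add: cinner_def sum_distrib_left scaleR_conv_of_real[where 'a=complex] mult_ac)

lemma cinner_commute: "cinner w v = cnj (cinner v w)"
  by (simp add: cinner_def mult.commute)

lemma cinner_self: "cinner v v = of_real (\<Sum>k\<in>UNIV. (cmod (v $ k))\<^sup>2)"
  by (simp only: cinner_def of_real_sum complex_norm_square)

lemma cinner_self_eq_0_iff: "cinner v v = 0 \<longleftrightarrow> v = 0"
  unfolding cinner_self of_real_eq_0_iff
  by (subst sum_nonneg_eq_0_iff) (auto simp: vec_eq_iff)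

lemma exists_unit_multiple:
  assumes "v \<noteq> 0"
  shows "\<exists>c. cinner (c *\<^sub>R v) (c *\<^sub>R v) = 1"
proof -
  define N where "N = (\<Sum>k\<in>UNIV. (cmod (v $ k))\<^sup>2)"
  have N: "cinner v v = of_real N" by (simp add: N_def cinner_self)
  have "N \<ge> 0" unfolding N_def by (intro sum_nonneg) auto
  moreover have "N \<noteq> 0" using assms N cinner_self_eq_0_iff[of v] by auto
  ultimately have "(1 / sqrt N) * (1 / sqrt N) * N = 1" by (simp add: field_simps)
  then have "cinner ((1 / sqrt N) *\<^sub>R v) ((1 / sqrt N) *\<^sub>R v) = 1"
    unfolding cinner_scaleR N of_real_mult[symmetric] by simp
  then show ?thesis ..
qed


section \<open>Extending orthonormal systems to bases\<close>

lemma orthonormal_independent: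
  assumes "orthonormal B"
  shows "vec.independent B"
  unfolding vec.independent_explicit_module
proof (intro allI impI)
  fix t u v
  assume t: "finite t" "t \<subseteq> B" and z: "(\<Sum>v\<in>t. u v *s v) = 0" and v: "v \<in> t"
  have "0 = cinner (\<Sum>w\<in>t. u w *s w) v" by (simp add: z cinner_def)
  also have "\<dots> = (\<Sum>w\<in>t. u w * (if w = v then 1 else 0))"
    unfolding cinner_sum_left using t v assms
    by (intro sum.cong) (auto simp: orthonormal_def subset_iff)
  also have "\<dots> = u v" using t v by (simp add: if_distrib cong: if_cong)
  finally show "u v = 0" by simp
qed

lemma orthonormal_finite_card:
  fixes B :: "('n::finite) ket set"
  assumes "orthonormal B"
  shows "finite B" "card B \<le> CARD('n)"
  using vec.independent_bound_general[OF orthonormal_independent[OF assms]] dim_subset_UNIV_cart_gen[of B]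
  by auto

text \<open>One Gram-Schmidt step: subtracting from \<open>x\<close> its orthogonal projection
  \<open>p\<close> onto the span leaves a nonzero vector orthogonal to \<open>B\<close>, which is
  then normalised.\<close>

lemma orthonormal_extend_insert:
  assumes B: "orthonormal B" and "x \<notin> vec.span B"
  obtains y where "y \<notin> B" "orthonormal (insert y B)"
proof -
  have fin: "finite B" using orthonormal_finite_card[OF B] by simp
  define p where "p = (\<Sum>b\<in>B. cinner x b *s b)"
  have "p \<in> vec.span B"
    unfolding p_def by (intro vec.span_sum vec.span_scale vec.span_base)
  then have "x - p \<noteq> 0" using assms by auto
  then obtain c where c: "cinner (c *\<^sub>R (x - p)) (c *\<^sub>R (x - p)) = 1"
    using exists_unit_multiple by blast
  have orth: "cinner (x - p) b = 0" if b: "b \<in> B" for b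
  proof -
    have "cinner p b = (\<Sum>a\<in>B. cinner x a * (if a = b then 1 else 0))"
      unfolding p_def cinner_sum_left using b B
      by (intro sum.cong) (auto simp: orthonormal_def)
    also have "\<dots> = cinner x b" using fin b by (simp add: if_distrib cong: if_cong)
    finally show ?thesis by (simp add: cinner_diff_left)
  qed
  define y where "y = c *\<^sub>R (x - p)"
  have y1: "cinner y b = 0" if "b \<in> B" for b
    using orth[OF that] cinner_scaleR[of c "x - p" 1 b] by (simp add: y_def)
  have y2: "cinner b y = 0" if "b \<in> B" for b
    using y1[OF that] cinner_commute[of b y] by simp
  have yy: "cinner y y = 1" using c by (simp add: y_def)
  have "y \<notin> B" using y1[of y] yy by auto
  moreover have "orthonormal (insert y B)"
    using B y1 y2 yy \<open>y \<notin> B\<close> by (auto simp: orthonormal_def)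
  ultimately show ?thesis using that by blast
qed

text \<open>Cardinalities of orthonormal sets are bounded by the dimension, so a largest orthonormal
  superset exists; if it did not span, a Gram-Schmidt step would enlarge it.\<close>

lemma orthonormal_extend_basis:
  fixes B :: "('n::finite) ket set"
  assumes "orthonormal B"
  obtains C where "B \<subseteq> C" "orthonormal C" "finite C" "card C = CARD('n)"
proof -
  let ?P = "\<lambda>C. B \<subseteq> C \<and> orthonormal C"
  obtain C where C: "?P C" and max: "\<And>D. ?P D \<Longrightarrow> card D \<le> card C"
    using ex_has_greatest_nat[of ?P B card "CARD('n) + 1"] assms orthonormal_finite_card(2)
    by (metis less_Suc_eq_le Suc_eq_plus1 subset_refl)
  have fin: "finite C" using C orthonormal_finite_card by blast
  have "vec.span C = UNIV"
  proof (rule ccontr)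
    assume "vec.span C \<noteq> UNIV"
    then obtain x where "x \<notin> vec.span C" by blast
    then obtain y where "y \<notin> C" "orthonormal (insert y C)"
      using orthonormal_extend_insert C by blast
    moreover from this C have "card (insert y C) \<le> card C" by (intro max) auto
    ultimately show False using fin by simp
  qed
  then have "card C = vec.dim (UNIV :: 'n ket set)"
    using orthonormal_independent C by (intro vec.basis_card_eq_dim) auto
  then have "card C = CARD('n)" using vec_dim_card by metis
  with C fin that show ?thesis by blast
qed

section \<open>Spectral decompositions and the entropy formula\<close>

definition has_spectrum :: "('n::finite) operator \<Rightarrow> ('n \<Rightarrow> real) \<Rightarrow> bool" where
  "has_spectrum A d \<longleftrightarrow> (\<exists>U. is_unitary U \<and> A = U ** diag_op d ** dagger U)"

lemma diag_op_mult_diag_op: "diag_op d ** diag_op e = diag_op (\<lambda>i. d i * e i)"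
  by (simp add: vec_eq_iff diag_op_mult) (simp add: diag_op_def)

lemma trace_diag_op: "trace (diag_op d) = of_real (\<Sum>i\<in>UNIV. d i)"
  by (simp add: trace_def diag_op_def)

lemma unitary_conj_diag_nth:
  "(U ** diag_op d ** dagger U) $ k $ l = (\<Sum>j\<in>UNIV. of_real (d j) * U $ k $ j * cnj (U $ l $ j))"
  by (simp add: matrix_matrix_mult_def[of "U ** diag_op d"] mult_diag_op dagger_def mult_ac)

text \<open>By \<open>fun_op_unique\<close> any diagonalisation may be used to evaluate the
  logarithm, and cyclicity of the trace then removes the unitary.\<close>

lemma entropy_has_spectrum:
  assumes "has_spectrum A d"
  shows "entropy A = - (\<Sum>i\<in>UNIV. d i * log 2 (d i))"
proof -
  obtain U where U: "is_unitary U" and A: "A = U ** diag_op d ** dagger U"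
    using assms by (auto simp: has_spectrum_def)
  let ?L = "U ** diag_op (log 2 \<circ> d) ** dagger U"
  have L: "fun_op (log 2) A = ?L"
    unfolding fun_op_def
    by (rule the_equality) (use U A fun_op_unique in blast)+
  have UU: "dagger U ** U = mat 1" using U by (simp add: is_unitary_def)
  have "A ** ?L = U ** diag_op d ** (dagger U ** U) ** diag_op (log 2 \<circ> d) ** dagger U"
    by (simp add: A matrix_mul_assoc)
  also have "\<dots> = U ** diag_op (\<lambda>i. d i * log 2 (d i)) ** dagger U"
    by (simp add: UU matrix_mul_assoc[symmetric] diag_op_mult_diag_op[symmetric] comp_def)
  finally have "trace (A ** ?L) = trace (dagger U ** U ** diag_op (\<lambda>i. d i * log 2 (d i)))"
    by (simp add: trace_mul_sym[of _ "dagger U"] matrix_mul_assoc)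
  then show ?thesis by (simp add: entropy_def L UU trace_diag_op)
qed

text \<open>Completing the \<open>v i\<close> to an orthonormal basis gives a full diagonalisation;
  the added vectors have eigenvalue 0 and contribute nothing to the entropy.\<close>

lemma entropy_orthonormal_sum:
  fixes v :: "'i \<Rightarrow> ('n::finite) ket"
  assumes fin: "finite I"
    and on: "\<And>i j. i \<in> I \<Longrightarrow> j \<in> I \<Longrightarrow> cinner (v i) (v j) = (if i = j then 1 else 0)"
  shows "entropy (\<Sum>i\<in>I. d i *\<^sub>R proj (v i)) = - (\<Sum>i\<in>I. d i * log 2 (d i))"
proof -
  have inj: "inj_on v I"
    by (rule inj_onI) (metis on zero_neq_one)
  have B: "orthonormal (v ` I)"
    using on by (auto simp: orthonormal_def inj_on_eq_iff[OF inj])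
  obtain C where C: "v ` I \<subseteq> C" "orthonormal C" "finite C" "card C = CARD('n)"
    using orthonormal_extend_basis[OF B] .
  then obtain g :: "'n \<Rightarrow> 'n ket" where g: "bij_betw g UNIV C"
    using finite_same_card_bij[of "UNIV :: 'n set" C] by auto
  define U :: "'n operator" where "U = (\<chi> k j. g j $ k)"
  define e where "e b = (if b \<in> v ` I then d (inv_into I v b) else 0)" for b
  have e: "e (v i) = d i" if "i \<in> I" for i using that inj by (simp add: e_def)
  \<comment> \<open>A sum over the completed basis collapses to \<open>I\<close> once its terms
    vanish on the added vectors. The codomain is general: the fact serves complex matrix entries and
    the real entropy sum.\<close>
  have sum_e: "(\<Sum>j\<in>UNIV. h (g j)) = (\<Sum>i\<in>I. h (v i))"
    if "\<And>b. e b = 0 \<Longrightarrow> b \<notin> v ` I \<Longrightarrow> h b = 0" for h :: "'n ket \<Rightarrow> 'x::comm_monoid_add"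
  proof -
    have "(\<Sum>j\<in>UNIV. h (g j)) = sum h C" by (rule sum.reindex_bij_betw[OF g])
    also have "\<dots> = sum h (v ` I)"
      by (rule sum.mono_neutral_right) (use C that in \<open>auto simp: e_def\<close>)
    also have "\<dots> = (\<Sum>i\<in>I. h (v i))" by (simp add: sum.reindex[OF inj])
    finally show ?thesis .
  qed
  have "dagger U ** U = mat 1"
  proof -
    have "(dagger U ** U) $ i $ j = cinner (g j) (g i)" for i j
      by (simp add: matrix_matrix_mult_def dagger_def U_def cinner_def mult.commute)
    moreover have "cinner (g j) (g i) = (if i = j then 1 else 0)" for i j
      using C g by (auto simp: orthonormal_def bij_betw_def inj_def)
    ultimately show ?thesis by (simp add: vec_eq_iff mat_def)
  qed
  then have "is_unitary U" by (simp add: is_unitary_def matrix_left_right_inverse[of U])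
  moreover have "(\<Sum>i\<in>I. d i *\<^sub>R proj (v i)) = U ** diag_op (e \<circ> g) ** dagger U"
  proof -
    have "(\<Sum>i\<in>I. d i *\<^sub>R proj (v i)) $ k $ l
        = (\<Sum>j\<in>UNIV. of_real (e (g j)) * g j $ k * cnj (g j $ l))" for k l
      by (subst sum_e) (auto simp: e ketbra_def scaleR_conv_of_real[where 'a=complex] mult.assoc)
    then show ?thesis by (simp add: vec_eq_iff unitary_conj_diag_nth) (simp add: U_def)
  qed
  ultimately have "has_spectrum (\<Sum>i\<in>I. d i *\<^sub>R proj (v i)) (e \<circ> g)"
    by (auto simp: has_spectrum_def)
  then have "entropy (\<Sum>i\<in>I. d i *\<^sub>R proj (v i)) = - (\<Sum>j\<in>UNIV. e (g j) * log 2 (e (g j)))"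
    by (simp add: entropy_has_spectrum)
  also have "\<dots> = - (\<Sum>i\<in>I. e (v i) * log 2 (e (v i)))"
    by (subst sum_e) auto
  finally show ?thesis by (simp add: e)
qed

section \<open>Randomness of a purified state\<close>

text \<open>The nonzero vectors are normalised, which turns their squared norms \<open>r i\<close>
  into eigenvalues; the zero vectors drop out on both sides.\<close>

lemma entropy_orthogonal_sum:
  fixes w :: "'i \<Rightarrow> ('n::finite) ket"
  assumes fin: "finite I"
    and orth: "\<And>i j. i \<in> I \<Longrightarrow> j \<in> I \<Longrightarrow> cinner (w i) (w j) = (if i = j then of_real (r i) else 0)"
  shows "entropy (\<Sum>i\<in>I. proj (w i)) = - (\<Sum>i\<in>I. r i * log 2 (r i))"
proof -
  define J where "J = {i\<in>I. r i \<noteq> 0}"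
  define v where "v i = (1 / sqrt (r i)) *\<^sub>R w i" for i
  have r_nonneg: "r i \<ge> 0" if "i \<in> I" for i
  proof -
    have "of_real (r i) = complex_of_real (\<Sum>k\<in>UNIV. (cmod (w i $ k))\<^sup>2)"
      using orth[OF that that] cinner_self[of "w i"] by simp
    then have "r i = (\<Sum>k\<in>UNIV. (cmod (w i $ k))\<^sup>2)" by (simp only: of_real_eq_iff)
    then show ?thesis by (simp add: sum_nonneg)
  qed
  have w0: "w i = 0" if "i \<in> I" "i \<notin> J" for i
    using orth[OF that(1) that(1)] that cinner_self_eq_0_iff[of "w i"] by (simp add: J_def)
  have proj_v: "r i *\<^sub>R proj (v i) = proj (w i)" if "i \<in> J" for i
  proof -
    have "(1 / sqrt (r i)) * (1 / sqrt (r i)) * r i = 1"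
      using that r_nonneg[of i] by (simp add: J_def)
    then have "complex_of_real (r i) * (of_real (1 / sqrt (r i)) * of_real (1 / sqrt (r i))) = 1"
      by (metis mult.commute of_real_1 of_real_mult)
    then show ?thesis
      by (simp add: v_def ketbra_def vec_eq_iff scaleR_conv_of_real[where 'a=complex]
          flip: of_real_mult)
  qed
  have "(\<Sum>i\<in>I. proj (w i)) = (\<Sum>i\<in>J. proj (w i))"
    by (rule sum.mono_neutral_right)
      (use fin w0 in \<open>auto simp: J_def ketbra_def vec_eq_iff\<close>)
  also have "\<dots> = (\<Sum>i\<in>J. r i *\<^sub>R proj (v i))"
    by (simp add: proj_v)
  also have "entropy \<dots> = - (\<Sum>i\<in>J. r i * log 2 (r i))"
  proof (rule entropy_orthonormal_sum)
    show "finite J" using fin by (simp add: J_def)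
    fix i j assume ij: "i \<in> J" "j \<in> J"
    then have "r i > 0" using r_nonneg[of i] by (simp add: J_def)
    then have "(1 / sqrt (r i) * (1 / sqrt (r i))) * r i = 1" by simp
    then show "cinner (v i) (v j) = (if i = j then 1 else 0)"
      using ij unfolding v_def cinner_scaleR
      by (auto simp: orth J_def simp del: of_real_mult simp flip: of_real_mult)
  qed
  also have "(\<Sum>i\<in>J. r i * log 2 (r i)) = (\<Sum>i\<in>I. r i * log 2 (r i))"
    by (rule sum.mono_neutral_left) (use fin in \<open>auto simp: J_def\<close>)
  finally show ?thesis .
qed

lemma dagger_mat_1: "dagger (mat 1) = mat 1"
  by (simp add: dagger_def mat_def vec_eq_iff)

lemma is_unitary_mat_1: "is_unitary (mat 1)"
  by (simp add: is_unitary_def dagger_mat_1)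

lemma has_spectrum_diag_op: "has_spectrum (diag_op d) d"
  unfolding has_spectrum_def
  by (rule exI[of _ "mat 1"]) (simp add: is_unitary_mat_1 dagger_mat_1)

lemma entropy_measured_state:
  fixes \<psi> :: "('q::finite \<times> 'e::finite) ket"
  assumes "purifies \<psi> \<rho>"
  shows "entropy (measured_state \<psi>) = entropy (diag_part \<rho>)"
proof -
  define r where "r i = (\<Sum>e\<in>UNIV. (cmod (\<psi> $ (i, e)))\<^sup>2)" for i
  \<comment> \<open>The branch of \<open>\<psi>\<close> for outcome \<open>i\<close>. Distinct
    branches have disjoint supports, hence are orthogonal, and the squared norm of a branch is the
    diagonal entry \<open>r i\<close> of \<open>\<rho>\<close>.\<close>
  define w where "w i = (\<chi> p. if fst p = i then \<psi> $ p else 0)" for i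
  have rho: "\<rho> = ptrace_snd (proj \<psi>)" using assms by (simp add: purifies_def)
  have "\<rho> $ i $ i = of_real (r i)" for i
    by (simp only: rho ptrace_snd_def ketbra_def r_def of_real_sum complex_norm_square vec_lambda_beta)
  then have "diag_part \<rho> = diag_op r"
    by (simp add: diag_part_def diag_op_def vec_eq_iff)
  moreover have "tensor_op (proj (ket i)) (block_op (proj \<psi>) i) = proj (w i)" for i
    by (auto simp: tensor_op_def ketbra_def ket_def axis_def block_op_def w_def vec_eq_iff)
  then have "measured_state \<psi> = (\<Sum>i\<in>UNIV. proj (w i))"
    by (simp add: measured_state_def)
  moreover have "cinner (w i) (w j) = (if i = j then of_real (r i) else 0)" for i j
  proof -
    have "cinner (w i) (w j) = (\<Sum>q\<in>UNIV. \<Sum>e\<in>UNIV. w i $ (q, e) * cnj (w j $ (q, e)))"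
      by (simp add: cinner_def sum.cartesian_product case_prod_beta flip: UNIV_Times_UNIV)
    also have "\<dots> = (\<Sum>q\<in>UNIV. if q = i then (if i = j then \<Sum>e\<in>UNIV. \<psi> $ (i, e) * cnj (\<psi> $ (i, e)) else 0) else 0)"
      by (rule sum.cong) (auto simp: w_def)
    also have "\<dots> = (if i = j then of_real (r i) else 0)"
      by (simp add: r_def complex_norm_square del: of_real_power)
    finally show ?thesis .
  qed
  ultimately show ?thesis
    by (simp add: entropy_orthogonal_sum[of UNIV w r] entropy_has_spectrum[OF has_spectrum_diag_op])
qed

text \<open>The measurement only deletes blocks that are off-diagonal in the first factor, and the
  partial trace over that factor does not see them.\<close>

lemma ptrace_fst_measured_state: "ptrace_fst (measured_state \<psi>) = ptrace_fst (proj \<psi>)"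
proof -
  have "measured_state \<psi> $ (q, e) $ (q, e') = proj \<psi> $ (q, e) $ (q, e')" for q e e'
  proof -
    have "measured_state \<psi> $ (q, e) $ (q, e')
        = (\<Sum>i\<in>UNIV. if i = q then proj \<psi> $ (q, e) $ (q, e') else 0)"
      unfolding measured_state_def sum_component
      by (rule sum.cong) (auto simp: tensor_op_def ketbra_def ket_def axis_def block_op_def)
    then show ?thesis by simp
  qed
  then show ?thesis by (simp add: ptrace_fst_def)
qed

text \<open>With the amplitudes of \<open>\<psi>\<close> written as a rectangular matrix \<open>P\<close>, the marginals are
  \<open>P P\<^sup>*\<close> and (up to transposition) \<open>P\<^sup>* P\<close>, so they share their nonzero spectrum.\<close>

lemma entropy_complementary_marginal:
  fixes \<psi> :: "('q::finite \<times> 'e::finite) ket"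
  assumes "purifies \<psi> \<rho>" and "has_spectrum \<rho> d"
  shows "entropy (ptrace_fst (proj \<psi>)) = entropy \<rho>"
proof -
  obtain U where U: "is_unitary U" and rho: "\<rho> = U ** diag_op d ** dagger U"
    using assms(2) by (auto simp: has_spectrum_def)
  define P :: "complex^'e^'q" where "P = (\<chi> q e. \<psi> $ (q, e))"
  define adj :: "complex^'e^'q \<Rightarrow> complex^'q^'e" where "adj M = (\<chi> e q. cnj (M $ q $ e))" for M
  \<comment> \<open>Rotating by the eigenbasis of \<open>\<rho>\<close> makes the rows orthogonal
    with squared norms \<open>d i\<close>, while the product in the other order is
    unchanged.\<close>
  define Y where "Y = dagger U ** P"
  have adjY: "adj Y = adj P ** U"
    by (simp add: adj_def Y_def dagger_def matrix_matrix_mult_def vec_eq_iff mult.commute)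
  have "P ** adj P = \<rho>"
    using assms(1)
    by (auto simp: purifies_def ptrace_snd_def ketbra_def matrix_matrix_mult_def P_def adj_def vec_eq_iff)
  then have "Y ** adj Y = dagger U ** \<rho> ** U"
    unfolding adjY by (simp add: Y_def matrix_mul_assoc) (metis matrix_mul_assoc)
  also have "\<dots> = (dagger U ** U) ** diag_op d ** (dagger U ** U)"
    by (simp add: rho matrix_mul_assoc)
  finally have YY: "Y ** adj Y = diag_op d"
    using U by (simp add: is_unitary_def)
  have orth: "cinner (Y $ i) (Y $ j) = (if i = j then of_real (d i) else 0)" for i j
  proof -
    have "cinner (Y $ i) (Y $ j) = (Y ** adj Y) $ i $ j"
      by (simp add: cinner_def matrix_matrix_mult_def adj_def)
    then show ?thesis by (simp add: YY diag_op_def)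
  qed
  have "adj Y ** Y = adj P ** (U ** dagger U) ** P"
    unfolding adjY by (simp add: Y_def matrix_mul_assoc)
  then have PP: "adj Y ** Y = adj P ** P"
    using U by (simp add: is_unitary_def)
  \<comment> \<open>The indices on the right are swapped. The same transposition occurs for the sum
    of the row projectors, so the two operators agree exactly.\<close>
  have "ptrace_fst (proj \<psi>) $ e $ e' = (adj P ** P) $ e' $ e" for e e'
    by (simp add: ptrace_fst_def ketbra_def matrix_matrix_mult_def adj_def P_def mult.commute)
  moreover have "(\<Sum>i\<in>UNIV. proj (Y $ i)) $ e $ e' = (adj Y ** Y) $ e' $ e" for e e'
    by (simp add: ketbra_def matrix_matrix_mult_def adj_def mult.commute)
  ultimately have "ptrace_fst (proj \<psi>) = (\<Sum>i\<in>UNIV. proj (Y $ i))"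
    by (simp add: vec_eq_iff PP)
  then show ?thesis
    using orth by (simp add: entropy_orthogonal_sum[of UNIV "\<lambda>i. Y $ i" d] entropy_has_spectrum[OF assms(2)])
qed

lemma randomness_eq_coherence:
  assumes "purifies (pur \<rho>) \<rho>" and "has_spectrum \<rho> d"
  shows "randomness pur \<rho> = coherence \<rho>"
  by (simp add: randomness_def cond_entropy_def coherence_def ptrace_fst_measured_state
      entropy_measured_state[OF assms(1)] entropy_complementary_marginal[OF assms])

section \<open>Block structure of two-qubit operators\<close>

lemma UNIV_bit: "(UNIV :: 2 set) = {0, 1}"
  using UNIV_2 by auto

lemma sum_bit: "sum f (UNIV :: 2 set) = f 0 + f 1"
  by (simp add: UNIV_bit)

lemma all_bit: "(\<forall>x::2. P x) \<longleftrightarrow> P 0 \<and> P 1"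
  using UNIV_bit by (metis UNIV_I empty_iff insert_iff)

lemma sum_bit_pair: "sum f (UNIV :: (2 \<times> 2) set) = f (0, 0) + f (0, 1) + f (1, 0) + f (1, 1)"
  by (simp add: sum_bit add.assoc sum.cartesian_product' flip: UNIV_Times_UNIV)

lemma all_bit_pair: "(\<forall>x::2 \<times> 2. P x) \<longleftrightarrow> P (0, 0) \<and> P (0, 1) \<and> P (1, 0) \<and> P (1, 1)"
  by (auto simp: split_paired_All all_bit)

text \<open>The shift \<open>k + 1\<close> in \<open>odd_block\<close> sends the bit 1 to the
  numeral \<open>2\<close>, which is the bit 0.\<close>

lemma two_eq_0_bit: "(2::2) = 0"
  by simp

text \<open>The sectors of equal and of opposite bits, both indexed by Alice's bit.\<close>

definition direct_sum :: "2 operator \<Rightarrow> 2 operator \<Rightarrow> two_qubit_op" where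
  "direct_sum A B = (\<chi> p q.
     if fst p = snd p then if fst q = snd q then A $ fst p $ fst q else 0
     else if fst q = snd q then 0 else B $ fst p $ fst q)"

definition even_block :: "two_qubit_op \<Rightarrow> 2 operator" where
  "even_block \<rho> = (\<chi> k l. \<rho> $ (k, k) $ (l, l))"

definition odd_block :: "two_qubit_op \<Rightarrow> 2 operator" where
  "odd_block \<rho> = (\<chi> k l. \<rho> $ (k, k + 1) $ (l, l + 1))"

definition herm2 :: "real \<Rightarrow> real \<Rightarrow> complex \<Rightarrow> 2 operator" where
  "herm2 p q z = (\<chi> k l. if k = l then if k = 0 then of_real p else of_real q
                      else if k = 0 then z else cnj z)"

lemmas two_qubit_entries =
  vec_eq_iff all_bit_pair all_bit two_eq_0_bit matrix_matrix_mult_def sum_bit sum_bit_pair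

lemma direct_sum_mult: "direct_sum A B ** direct_sum A' B' = direct_sum (A ** A') (B ** B')"
  by (simp add: two_qubit_entries direct_sum_def)

lemma dagger_direct_sum: "dagger (direct_sum A B) = direct_sum (dagger A) (dagger B)"
  by (simp add: two_qubit_entries direct_sum_def dagger_def)

lemma direct_sum_mat_1: "direct_sum (mat 1) (mat 1) = mat 1"
  by (simp add: two_qubit_entries direct_sum_def mat_def)

lemma direct_sum_diag_op:
  "direct_sum (diag_op d) (diag_op e) = diag_op (\<lambda>p. if fst p = snd p then d (fst p) else e (fst p))"
  by (simp add: two_qubit_entries direct_sum_def diag_op_def)

lemma Pi_plus_conj: "Pi_plus ** \<rho> ** Pi_plus = direct_sum (even_block \<rho>) 0"
  by (simp add: two_qubit_entries direct_sum_def even_block_def Pi_plus_def ketbra_def ket_def axis_def)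

lemma Pi_minus_conj: "Pi_minus ** \<rho> ** Pi_minus = direct_sum 0 (odd_block \<rho>)"
  by (simp add: two_qubit_entries direct_sum_def odd_block_def Pi_minus_def ketbra_def ket_def axis_def)

lemma direct_sum_add: "direct_sum A B + direct_sum A' B' = direct_sum (A + A') (B + B')"
  by (simp add: two_qubit_entries direct_sum_def)

lemma Phi_eq_direct_sum: "Phi \<rho> = direct_sum (even_block \<rho>) (odd_block \<rho>)"
  by (simp add: Phi_def Pi_plus_conj Pi_minus_conj direct_sum_add)

lemma trace_Pi_plus: "trace (Pi_plus ** \<rho>) = \<rho> $ (0, 0) $ (0, 0) + \<rho> $ (1, 1) $ (1, 1)"
  by (simp add: two_qubit_entries trace_def Pi_plus_def ketbra_def ket_def axis_def)

lemma trace_Pi_minus: "trace (Pi_minus ** \<rho>) = \<rho> $ (0, 1) $ (0, 1) + \<rho> $ (1, 0) $ (1, 0)"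
  by (simp add: two_qubit_entries trace_def Pi_minus_def ketbra_def ket_def axis_def)

lemma bit_flip_conj: "bit_flip_B ** direct_sum A B ** bit_flip_B = direct_sum B A"
  by (simp add: two_qubit_entries direct_sum_def bit_flip_B_def tensor_op_def mat_def
      ketbra_def ket_def axis_def)

text \<open>With X the bit flip, \<open>Pi_x_minus\<close> is (1 - X \<otimes> X) / 2, so apart from
  the trace only the four antidiagonal entries enter.\<close>

lemma trace_Pi_x_minus:
  "trace (Pi_x_minus ** \<rho>) = (trace \<rho> - \<rho> $ (0, 0) $ (1, 1) - \<rho> $ (1, 1) $ (0, 0)
     - \<rho> $ (0, 1) $ (1, 0) - \<rho> $ (1, 0) $ (0, 1)) / 2"
proof -
  have s: "complex_of_real (1 / sqrt 2) * complex_of_real (1 / sqrt 2) = 1 / 2"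
    by (simp flip: of_real_mult)
  have plus: "ket_plus $ k = of_real (1 / sqrt 2)" for k
    using all_bit[of "\<lambda>k. ket_plus $ k = of_real (1 / sqrt 2)"]
    by (simp add: ket_plus_def ket_def axis_def scaleR_conv_of_real[where 'a=complex])
  have s2: "complex_of_real (sqrt 2) * complex_of_real (sqrt 2) = 2"
    by (simp flip: of_real_mult)
  have minus: "ket_minus $ k = of_real (1 / sqrt 2) * (if k = 0 then 1 else - 1)" for k
    using all_bit[of "\<lambda>k. ket_minus $ k = of_real (1 / sqrt 2) * (if k = 0 then 1 else - 1)"]
    by (simp add: ket_minus_def ket_def axis_def scaleR_conv_of_real[where 'a=complex])
  \<comment> \<open>The sign of an amplitude depends only on the qubit that is in the minus
    state.\<close>
  have "tensor_ket ket_plus ket_minus $ p = (if snd p = 0 then 1 / 2 else - (1 / 2))"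
    "tensor_ket ket_minus ket_plus $ p = (if fst p = 0 then 1 / 2 else - (1 / 2))" for p
    unfolding tensor_ket_def vec_lambda_beta plus minus
    by (simp_all only: mult.assoc[symmetric] s mult.commute[of _ "if _ then _ else _"])
      (simp_all add: s2)
  then have "Pi_x_minus $ p $ q
      = (if snd p = 0 then 1 / 2 else - (1 / 2)) * (if snd q = 0 then 1 / 2 else - (1 / 2))
      + (if fst p = 0 then 1 / 2 else - (1 / 2)) * (if fst q = 0 then 1 / 2 else - (1 / 2))" for p q
    by (simp add: Pi_x_minus_def ketbra_def)
  then show ?thesis
    by (simp add: trace_def matrix_matrix_mult_def sum_bit_pair)
qed

section \<open>Diagonalisation of the blocks\<close>

lemma has_spectrum_direct_sum:
  assumes "has_spectrum A d" and "has_spectrum B e"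
  shows "has_spectrum (direct_sum A B) (\<lambda>p. if fst p = snd p then d (fst p) else e (fst p))"
proof -
  obtain U V where U: "is_unitary U" "A = U ** diag_op d ** dagger U"
    and V: "is_unitary V" "B = V ** diag_op e ** dagger V"
    using assms by (auto simp: has_spectrum_def)
  have "is_unitary (direct_sum U V)"
    using U V by (simp add: is_unitary_def dagger_direct_sum direct_sum_mult direct_sum_mat_1)
  moreover have "direct_sum A B = direct_sum U V
      ** diag_op (\<lambda>p. if fst p = snd p then d (fst p) else e (fst p)) ** dagger (direct_sum U V)"
    by (simp add: U V dagger_direct_sum direct_sum_mult flip: direct_sum_diag_op)
  ultimately show ?thesis by (auto simp: has_spectrum_def)
qed

text \<open>Half the distance between the two eigenvalues of a Hermitian matrix with diagonal
  \<open>p\<close>, \<open>q\<close> and off-diagonal modulus \<open>t\<close>.\<close>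

definition eigen_gap :: "real \<Rightarrow> real \<Rightarrow> real \<Rightarrow> real" where
  "eigen_gap p q t = sqrt (((p - q) / 2)\<^sup>2 + t\<^sup>2)"

lemma has_spectrum_herm2:
  "has_spectrum (herm2 p q z)
     (\<lambda>k. if k = 0 then (p + q) / 2 + eigen_gap p q (cmod z)
          else (p + q) / 2 - eigen_gap p q (cmod z))"
proof -
  define s where "s = eigen_gap p q (cmod z)"
  \<comment> \<open>With this parameter the eigenvalues are \<open>p + \<delta>\<close> and
    \<open>q - \<delta>\<close>, and \<open>N\<close> turns out to be
    \<open>(cmod z)\<^sup>2 + \<delta>\<^sup>2\<close>, the squared norm of each eigenvector used
    below.\<close>
  define \<delta> where "\<delta> = s - (p - q) / 2"
  define N where "N = 2 * s * \<delta>"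
  have "\<bar>(p - q) / 2\<bar> \<le> s"
    unfolding s_def eigen_gap_def by (rule real_le_rsqrt) (simp only: power2_abs, simp)
  then have "s \<ge> 0" "\<delta> \<ge> 0" by (auto simp: \<delta>_def)
  have "s\<^sup>2 = ((p - q) / 2)\<^sup>2 + (cmod z)\<^sup>2"
    by (simp add: s_def eigen_gap_def)
  then have zz: "(cmod z)\<^sup>2 = \<delta> * (2 * s - \<delta>)"
    by (simp add: \<delta>_def power2_eq_square field_simps)
  have cz: "z * cnj z = of_real (\<delta> * (2 * s - \<delta>))"
    by (simp only: complex_norm_square[symmetric] zz)
  have ev: "(p + q) / 2 + s = p + \<delta>" "(p + q) / 2 - s = p + \<delta> - 2 * s"
    and q: "q = p + 2 * \<delta> - 2 * s"
    by (simp_all add: \<delta>_def field_simps)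
  let ?d = "\<lambda>k::2. if k = 0 then p + \<delta> else p + \<delta> - 2 * s"
  have "\<exists>U. is_unitary U \<and> herm2 p q z = U ** diag_op ?d ** dagger U"
  proof (cases "N = 0")
    \<comment> \<open>Here the eigenvector formula degenerates to 0, but the matrix is already
      diagonal, with its eigenvalues in the required order.\<close>
    case True
    moreover have "N = (cmod z)\<^sup>2 + \<delta>\<^sup>2"
      unfolding zz by (simp add: N_def power2_eq_square algebra_simps)
    ultimately have "z = 0" "\<delta> = 0" by (simp_all add: sum_power2_eq_zero_iff)
    then have "herm2 p q z = diag_op ?d"
      by (simp add: two_qubit_entries herm2_def diag_op_def q)
    then show ?thesis
      by (intro exI[of _ "mat 1"]) (simp add: is_unitary_mat_1 dagger_mat_1)
  next
    case False
    then have "N > 0" using \<open>s \<ge> 0\<close> \<open>\<delta> \<ge> 0\<close> by (simp add: N_def)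
    define c where "c = 1 / sqrt N"
    have "c * c * N = 1" using \<open>N > 0\<close> by (simp add: c_def)
    then have "complex_of_real (c * c * N) = 1" by (simp only: of_real_1)
    then have cN: "complex_of_real c * c * (2 * s * \<delta>) = 1"
      by (simp only: N_def of_real_mult of_real_numeral)
    \<comment> \<open>the columns are eigenvectors: \<open>(z, \<delta>)\<close> for \<open>p + \<delta>\<close> and \<open>(\<delta>, - cnj z)\<close> for \<open>q - \<delta>\<close>\<close>
    define U :: "2 operator" where
      "U = (\<chi> k l. of_real c * (if k \<noteq> l then of_real \<delta> else if k = 0 then z else - cnj z))"
    have U: "U $ 0 $ 0 = of_real c * z" "U $ 0 $ 1 = of_real c * of_real \<delta>"
      "U $ 1 $ 0 = of_real c * of_real \<delta>" "U $ 1 $ 1 = - (of_real c * cnj z)"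
      by (simp_all add: U_def)
    \<comment> \<open>Treating the conjugate \<open>w\<close> as an independent variable reduces
      unitarity and diagonalisation to polynomial identities modulo the two equations
      \<open>eqs\<close>.\<close>
    define C D S P w where "C = complex_of_real c" and "D = complex_of_real \<delta>"
      and "S = complex_of_real s" and "P = complex_of_real p" and "w = cnj z"
    have eqs: "C * C * (2 * S * D) = 1" "z * w = D * (2 * S - D)"
      using cN cz by (simp_all only: C_def D_def S_def w_def of_real_mult of_real_diff of_real_numeral)
    have "U ** dagger U = mat 1"
    proof -
      have "C * z * (C * w) + C * D * (C * D) = 1" using eqs by algebra
      moreover have "C * z * (C * D) + C * D * - (C * z) = 0" by algebra
      moreover have "C * D * (C * w) + - (C * w) * (C * D) = 0" by algebra
      moreover have "C * D * (C * D) + - (C * w) * - (C * z) = 1" using eqs by algebra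
      ultimately show ?thesis
        by (simp only: vec_eq_iff all_bit) (simp add: matrix_matrix_mult_def sum_bit dagger_def mat_def U C_def D_def w_def)
    qed
    moreover have "herm2 p q z = U ** diag_op ?d ** dagger U"
    proof -
      have "(P + D) * (C * z) * (C * w) + (P + D - 2 * S) * (C * D) * (C * D) = P"
        using eqs by algebra
      moreover have "(P + D) * (C * z) * (C * D) + (P + D - 2 * S) * (C * D) * (- (C * z)) = z"
        using eqs by algebra
      moreover have "(P + D) * (C * D) * (C * w) + (P + D - 2 * S) * (- (C * w)) * (C * D) = w"
        using eqs by algebra
      moreover have "(P + D) * (C * D) * (C * D) + (P + D - 2 * S) * (- (C * w)) * (- (C * z)) = P + 2 * D - 2 * S"
        using eqs by algebra
      ultimately show ?thesis
        by (simp only: vec_eq_iff all_bit unitary_conj_diag_nth sum_bit)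
          (simp add: herm2_def U C_def D_def S_def P_def w_def q)
    qed
    ultimately show ?thesis
      using matrix_left_right_inverse[of U] is_unitary_def by blast
  qed
  then show ?thesis
    by (simp only: has_spectrum_def ev flip: s_def)
qed

section \<open>Coherence of a block\<close>

definition xlog :: "real \<Rightarrow> real" where
  "xlog x = x * log 2 x"

lemma xlog_scale:
  assumes "c > 0" "x \<ge> 0"
  shows "xlog (c * x) = c * xlog x + x * xlog c"
  using assms by (cases "x = 0") (auto simp: xlog_def log_mult_pos algebra_simps)

text \<open>Convexity: the graph lies above its tangent at \<open>y\<close>. This comes from
  \<open>ln u \<le> u - 1\<close> at \<open>u = y / x\<close>; at \<open>x = 0\<close> the term
  \<open>x * ln x\<close> vanishes.\<close>

lemma xlog_tangent:
  assumes "y > 0" "x \<ge> 0"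
  shows "xlog x \<ge> xlog y + (log 2 y + 1 / ln 2) * (x - y)"
proof -
  have "x * (ln y - ln x) \<le> y - x"
  proof (cases "x = 0")
    case False
    then have "x > 0" using assms by simp
    have "ln (y / x) \<le> y / x - 1" using assms \<open>x > 0\<close> by (intro ln_le_minus_one) simp
    then have "x * ln (y / x) \<le> x * (y / x - 1)" using \<open>x > 0\<close> by (intro mult_left_mono) auto
    then show ?thesis using \<open>x > 0\<close> assms by (simp add: ln_div algebra_simps)
  qed (use assms in auto)
  then have "y * ln y + (ln y + 1) * (x - y) \<le> x * ln x"
    by (simp add: algebra_simps)
  then have "(y * ln y + (ln y + 1) * (x - y)) / ln 2 \<le> (x * ln x) / ln 2"
    by (intro divide_right_mono) auto
  then show ?thesis by (simp add: xlog_def log_def add_divide_distrib distrib_right)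
qed

text \<open>Moving two points apart about a fixed midpoint increases the sum of a convex function.
  The tangents are taken at the inner points, which are positive when \<open>s < s'\<close>; the
  outer point \<open>m - s'\<close> may be 0.\<close>

lemma xlog_spread_mono:
  assumes "0 \<le> s" "s \<le> s'" "s' \<le> m"
  shows "xlog (m + s) + xlog (m - s) \<le> xlog (m + s') + xlog (m - s')"
proof (cases "s = s'")
  case False
  then have pos: "m - s > 0" "m + s > 0" using assms by auto
  have "log 2 (m - s) \<le> log 2 (m + s)" using pos assms by simp
  then have "0 \<le> (log 2 (m + s) - log 2 (m - s)) * (s' - s)" using assms by simp
  moreover have "xlog (m + s') \<ge> xlog (m + s) + (log 2 (m + s) + 1 / ln 2) * (s' - s)"
    using xlog_tangent[of "m + s" "m + s'"] pos assms by simp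
  moreover have "xlog (m - s') \<ge> xlog (m - s) + (log 2 (m - s) + 1 / ln 2) * (s - s')"
    using xlog_tangent[of "m - s" "m - s'"] pos assms by simp
  ultimately show ?thesis by (simp add: algebra_simps diff_divide_distrib)
qed simp

text \<open>The contribution of one unnormalised block: entropy of its diagonal minus entropy of its
  eigenvalues.\<close>

definition block_coherence :: "real \<Rightarrow> real \<Rightarrow> real \<Rightarrow> real" where
  "block_coherence p q t =
     xlog ((p + q) / 2 + eigen_gap p q t) + xlog ((p + q) / 2 - eigen_gap p q t) - xlog p - xlog q"

text \<open>A nonnegative determinant makes the smaller eigenvalue nonnegative, as the convexity and
  scaling of \<open>xlog\<close> require.\<close>

lemma eigen_gap_le:
  assumes "0 \<le> p" "0 \<le> q" "t\<^sup>2 \<le> p * q"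
  shows "eigen_gap p q t \<le> (p + q) / 2"
proof -
  have "((p - q) / 2)\<^sup>2 + t\<^sup>2 \<le> ((p + q) / 2)\<^sup>2"
    using assms(3) by (simp add: power2_eq_square field_simps)
  then show ?thesis unfolding eigen_gap_def using assms by (intro real_le_lsqrt) auto
qed

lemma block_coherence_mono:
  assumes "0 \<le> p" "0 \<le> q" "0 \<le> t" "t \<le> t'" "t'\<^sup>2 \<le> p * q"
  shows "block_coherence p q t \<le> block_coherence p q t'"
proof -
  have "eigen_gap p q t \<le> eigen_gap p q t'"
    unfolding eigen_gap_def using assms by (simp add: power_mono)
  then show ?thesis
    using xlog_spread_mono[OF _ _ eigen_gap_le[of p q t'], of "eigen_gap p q t"] assms
    by (simp add: block_coherence_def eigen_gap_def)
qed

lemma block_coherence_0: "block_coherence 0 0 0 = 0"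
  by (simp add: block_coherence_def eigen_gap_def xlog_def)

lemma eigen_gap_scale:
  assumes "c > 0"
  shows "eigen_gap (c * p) (c * q) (c * t) = c * eigen_gap p q t"
proof -
  have "((c * p - c * q) / 2)\<^sup>2 + (c * t)\<^sup>2 = c\<^sup>2 * (((p - q) / 2)\<^sup>2 + t\<^sup>2)"
    by (simp add: power2_eq_square field_simps)
  then show ?thesis using assms by (simp add: eigen_gap_def real_sqrt_mult)
qed

text \<open>Scaling adds a multiple of \<open>xlog c\<close> to each term; these additions cancel
  because the eigenvalues and the diagonal have the same sum.\<close>

lemma block_coherence_scale:
  assumes "c > 0" "0 \<le> p" "0 \<le> q" "t\<^sup>2 \<le> p * q"
  shows "block_coherence (c * p) (c * q) (c * t) = c * block_coherence p q t"
proof -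
  have "0 \<le> eigen_gap p q t" by (simp add: eigen_gap_def)
  with eigen_gap_le[of p q t] assms
  have nn: "0 \<le> (p + q) / 2 + eigen_gap p q t" "0 \<le> (p + q) / 2 - eigen_gap p q t" by auto
  have "(c * p + c * q) / 2 + c * eigen_gap p q t = c * ((p + q) / 2 + eigen_gap p q t)"
    "(c * p + c * q) / 2 - c * eigen_gap p q t = c * ((p + q) / 2 - eigen_gap p q t)"
    by (simp_all add: algebra_simps add_divide_distrib)
  then show ?thesis
    unfolding block_coherence_def eigen_gap_scale[OF assms(1)]
    by (simp only: xlog_scale[OF assms(1) nn(1)] xlog_scale[OF assms(1) nn(2)]
        xlog_scale[OF assms(1,2)] xlog_scale[OF assms(1,3)]) (simp add: field_simps)
qed

lemma has_spectrum_two_blocks: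
  "has_spectrum (direct_sum (herm2 p q z) (herm2 r u w))
     (\<lambda>i. if fst i = snd i
          then if fst i = 0 then (p + q) / 2 + eigen_gap p q (cmod z)
               else (p + q) / 2 - eigen_gap p q (cmod z)
          else if fst i = 0 then (r + u) / 2 + eigen_gap r u (cmod w)
               else (r + u) / 2 - eigen_gap r u (cmod w))"
  by (rule has_spectrum_direct_sum[OF has_spectrum_herm2 has_spectrum_herm2])

lemma coherence_two_blocks:
  "coherence (direct_sum (herm2 p q z) (herm2 r u w))
     = block_coherence p q (cmod z) + block_coherence r u (cmod w)"
proof -
  have "diag_part (direct_sum (herm2 p q z) (herm2 r u w))
      = diag_op (\<lambda>i. if fst i = snd i then if fst i = 0 then p else q
                     else if fst i = 0 then r else u)"
    by (simp add: two_qubit_entries diag_part_def direct_sum_def herm2_def diag_op_def)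
  then show ?thesis
    by (simp add: coherence_def entropy_has_spectrum[OF has_spectrum_diag_op]
        entropy_has_spectrum[OF has_spectrum_two_blocks] sum_bit_pair block_coherence_def xlog_def)
qed

section \<open>Positivity and two-by-two minors\<close>

lemma quadratic_form_nonneg:
  fixes a b z :: complex
  assumes "0 \<le> p" "0 \<le> q" "(cmod z)\<^sup>2 \<le> p * q"
  shows "0 \<le> Re (cnj a * (of_real p * a + z * b) + cnj b * (cnj z * a + of_real q * b))"
proof -
  have "cmod z \<le> sqrt p * sqrt q"
    using assms by (simp add: real_le_rsqrt flip: real_sqrt_mult)
  then have "cmod a * cmod b * cmod z \<le> cmod a * cmod b * (sqrt p * sqrt q)"
    by (intro mult_left_mono) auto
  moreover have "- Re (cnj a * z * b) \<le> cmod a * cmod b * cmod z"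
    using abs_Re_le_cmod[of "cnj a * z * b"] by (simp add: norm_mult mult_ac)
  \<comment> \<open>The arithmetic-geometric mean inequality lets the diagonal terms absorb the
    cross term.\<close>
  moreover have "0 \<le> (sqrt p * cmod a - sqrt q * cmod b)\<^sup>2" by simp
  then have "2 * (cmod a * cmod b * (sqrt p * sqrt q)) \<le> p * (cmod a)\<^sup>2 + q * (cmod b)\<^sup>2"
    using assms by (simp add: power2_diff power_mult_distrib mult_ac)
  moreover have "Re (cnj a * (of_real p * a + z * b) + cnj b * (cnj z * a + of_real q * b))
      = p * (cmod a)\<^sup>2 + q * (cmod b)\<^sup>2 + 2 * Re (cnj a * z * b)"
    unfolding cmod_power2 by (simp add: power2_eq_square algebra_simps)
  ultimately show ?thesis by linarith
qed

lemma is_density_two_blocks: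
  assumes "0 \<le> p" "0 \<le> q" "0 \<le> r" "0 \<le> u" "(cmod z)\<^sup>2 \<le> p * q" "(cmod w)\<^sup>2 \<le> r * u"
    and "p + q + r + u = 1"
  shows "is_density (direct_sum (herm2 p q z) (herm2 r u w))"
  unfolding is_density_def
proof (intro conjI allI)
  let ?\<rho> = "direct_sum (herm2 p q z) (herm2 r u w)"
  show "dagger ?\<rho> = ?\<rho>"
    by (simp add: two_qubit_entries direct_sum_def herm2_def dagger_def)
  show "trace ?\<rho> = 1"
    using assms(7) by (simp add: trace_def sum_bit_pair direct_sum_def herm2_def algebra_simps
        flip: of_real_add)
  fix v :: "(2 \<times> 2) ket"
  let ?a = "v $ (0, 0)" and ?b = "v $ (1, 1)" and ?c = "v $ (0, 1)" and ?d = "v $ (1, 0)"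
  have "(\<Sum>i\<in>UNIV. cnj (v $ i) * (?\<rho> *v v) $ i)
      = (cnj ?a * (of_real p * ?a + z * ?b) + cnj ?b * (cnj z * ?a + of_real q * ?b))
      + (cnj ?c * (of_real r * ?c + w * ?d) + cnj ?d * (cnj w * ?c + of_real u * ?d))"
    by (simp add: sum_bit_pair matrix_vector_mult_def direct_sum_def herm2_def)
  then show "0 \<le> Re (\<Sum>i\<in>UNIV. cnj (v $ i) * (?\<rho> *v v) $ i)"
    using quadratic_form_nonneg[OF assms(1,2,5), of ?a ?b] quadratic_form_nonneg[OF assms(3,4,6), of ?c ?d]
    by simp
qed

lemma density_hermitian: "is_density \<rho> \<Longrightarrow> \<rho> $ j $ i = cnj (\<rho> $ i $ j)"
  by (auto simp: is_density_def dagger_def vec_eq_iff)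

lemma density_diag_real: "is_density \<rho> \<Longrightarrow> \<rho> $ i $ i = of_real (Re (\<rho> $ i $ i))"
  using density_hermitian[of \<rho> i i] by (simp add: complex_eq_iff)

text \<open>Testing positivity on vectors supported on \<open>i\<close> and \<open>j\<close> reduces
  the claim to a discriminant argument for a real quadratic.\<close>

lemma density_minor_nonneg:
  assumes rho: "is_density \<rho>" and "i \<noteq> j"
  shows "(cmod (\<rho> $ i $ j))\<^sup>2 \<le> Re (\<rho> $ i $ i) * Re (\<rho> $ j $ j)"
proof -
  define z p q where "z = \<rho> $ i $ j" and "p = Re (\<rho> $ i $ i)" and "q = Re (\<rho> $ j $ j)"
  have entries: "\<rho> $ i $ i = of_real p" "\<rho> $ j $ j = of_real q" "\<rho> $ i $ j = z" "\<rho> $ j $ i = cnj z"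
    using density_diag_real[OF rho] density_hermitian[OF rho, of j i] by (auto simp: p_def q_def z_def)
  have form: "0 \<le> p * (cmod a)\<^sup>2 + q * (cmod b)\<^sup>2 + 2 * Re (cnj a * z * b)" for a b
  proof -
    define v where "v = (\<chi> k. if k = i then a else if k = j then b else 0)"
    have two: "(\<Sum>k\<in>UNIV. g k) = g i + g j" if "\<And>k. k \<noteq> i \<Longrightarrow> k \<noteq> j \<Longrightarrow> g k = 0" for g :: "_ \<Rightarrow> complex"
    proof -
      have "(\<Sum>k\<in>UNIV. g k) = (\<Sum>k\<in>{i, j}. g k)"
        by (rule sum.mono_neutral_right) (use that in auto)
      then show ?thesis using \<open>i \<noteq> j\<close> by simp
    qed
    have mv: "(\<rho> *v v) $ k = \<rho> $ k $ i * a + \<rho> $ k $ j * b" for k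
      unfolding matrix_vector_mult_def vec_lambda_beta
      by (subst two) (use \<open>i \<noteq> j\<close> in \<open>auto simp: v_def\<close>)
    have "(\<Sum>k\<in>UNIV. cnj (v $ k) * (\<rho> *v v) $ k)
        = cnj a * (\<rho> $ i $ i * a + \<rho> $ i $ j * b) + cnj b * (\<rho> $ j $ i * a + \<rho> $ j $ j * b)"
      unfolding mv by (subst two) (use \<open>i \<noteq> j\<close> in \<open>auto simp: v_def\<close>)
    moreover have "0 \<le> Re (\<Sum>k\<in>UNIV. cnj (v $ k) * (\<rho> *v v) $ k)"
      using rho by (simp add: is_density_def)
    moreover have "Re (cnj a * (\<rho> $ i $ i * a + \<rho> $ i $ j * b) + cnj b * (\<rho> $ j $ i * a + \<rho> $ j $ j * b))
        = p * (cmod a)\<^sup>2 + q * (cmod b)\<^sup>2 + 2 * Re (cnj a * z * b)"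
      unfolding cmod_power2 entries by (simp add: power2_eq_square algebra_simps)
    ultimately show ?thesis by simp
  qed
  have nn: "0 \<le> p" "0 \<le> q" using form[of 1 0] form[of 0 1] by auto
  \<comment> \<open>Choosing the first amplitude as \<open>- x * z\<close> aligns its phase with
    \<open>z\<close>, so the cross term is real and negative for positive \<open>x\<close>.\<close>
  have disc: "0 \<le> p * x\<^sup>2 * (cmod z)\<^sup>2 - 2 * x * (cmod z)\<^sup>2 + q" for x :: real
    using form[of "- of_real x * z" 1] unfolding cmod_power2
    by (simp add: power2_eq_square algebra_simps)
  have "(cmod z)\<^sup>2 \<le> p * q"
  proof (cases "p = 0")
    case True
    have "cmod z = 0"
    proof (rule ccontr)
      assume "cmod z \<noteq> 0"
      \<comment> \<open>For \<open>p = 0\<close> the form is affine in \<open>x\<close>; this value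
        makes it \<open>- q - 2\<close>.\<close>
      then show False using disc[of "(q + 1) / (cmod z)\<^sup>2"] nn True by simp
    qed
    then show ?thesis using True by simp
  next
    case False
    \<comment> \<open>The value \<open>1 / p\<close> minimises the quadratic when \<open>z\<close>
      is nonzero.\<close>
    then show ?thesis using disc[of "1 / p"] nn by (simp add: power2_eq_square field_simps)
  qed
  then show ?thesis by (simp add: z_def p_def q_def)
qed

section \<open>The key rate\<close>

lemma direct_sum_scaleR: "c *\<^sub>R direct_sum A B = direct_sum (c *\<^sub>R A) (c *\<^sub>R B)"
  by (simp add: two_qubit_entries direct_sum_def)

lemma herm2_scaleR: "c *\<^sub>R herm2 p q z = herm2 (c * p) (c * q) (c *\<^sub>R z)"
  by (simp add: two_qubit_entries herm2_def scaleR_conv_of_real[where 'a=complex])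

lemma herm2_0: "herm2 0 0 0 = 0"
  by (simp add: two_qubit_entries herm2_def)

lemma even_block_direct_sum: "even_block (direct_sum A B) = A"
  by (simp add: two_qubit_entries direct_sum_def even_block_def)

lemma odd_block_direct_sum: "odd_block (direct_sum A B) = B"
  by (simp add: two_qubit_entries direct_sum_def odd_block_def)

lemma density_blocks:
  assumes "is_density \<rho>"
  shows "even_block \<rho> = herm2 (Re (\<rho> $ (0,0) $ (0,0))) (Re (\<rho> $ (1,1) $ (1,1))) (\<rho> $ (0,0) $ (1,1))"
    and "odd_block \<rho> = herm2 (Re (\<rho> $ (0,1) $ (0,1))) (Re (\<rho> $ (1,0) $ (1,0))) (\<rho> $ (0,1) $ (1,0))"
  using density_diag_real[OF assms, symmetric] density_hermitian[OF assms, of "(0,0)" "(1,1)"]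
    density_hermitian[OF assms, of "(0,1)" "(1,0)"]
  by (simp_all add: two_qubit_entries even_block_def odd_block_def herm2_def)

lemma rho_ab_eq_direct_sum:
  "rho_ab m00 m11 m22 m33 a b
     = direct_sum (herm2 m00 m33 (of_real a)) (herm2 m11 m22 (of_real b))"
  by (simp add: two_qubit_entries rho_ab_def direct_sum_def herm2_def ketbra_def ket_def axis_def
      scaleR_conv_of_real[where 'a=complex])

text \<open>The weight \<open>e\<close> undoes the normalisation by homogeneity of the block
  coherence. For weight zero the omitted term agrees with the coherence of a vanishing
  block.\<close>

lemma weighted_randomness_sector:
  assumes pur: "\<And>\<rho>. is_density \<rho> \<Longrightarrow> purifies (pur \<rho>) \<rho>"
    and "0 \<le> p" "0 \<le> q" "(cmod z)\<^sup>2 \<le> p * q" and e: "e = p + q"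
  shows "(if e = 0 then 0 else e * randomness pur (direct_sum ((1 / e) *\<^sub>R herm2 p q z) 0))
      = block_coherence p q (cmod z)"
proof (cases "e = 0")
  case True
  then have "p = 0" "q = 0" using assms by auto
  then show ?thesis using True assms(4) by (simp add: block_coherence_0)
next
  case False
  then have "e > 0" using assms by auto
  define c where "c = 1 / e"
  have c: "c > 0" "e * c = 1" using \<open>e > 0\<close> by (auto simp: c_def)
  have norm_z: "cmod (c *\<^sub>R z) = c * cmod z" using c by simp
  \<comment> \<open>The empty sector is written as a zero Hermitian block, so that the two-block
    results apply.\<close>
  let ?\<sigma> = "direct_sum (herm2 (c * p) (c * q) (c *\<^sub>R z)) (herm2 0 0 0)"
  have "(c * cmod z)\<^sup>2 \<le> c * p * (c * q)"
    using mult_left_mono[OF assms(4), of "c\<^sup>2"] by (simp add: power2_eq_square mult_ac)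
  moreover have "c * p + c * q = 1" using c(2) e by (simp add: algebra_simps)
  ultimately have "is_density ?\<sigma>"
    using assms c norm_z by (intro is_density_two_blocks) auto
  then have "randomness pur ?\<sigma> = coherence ?\<sigma>"
    using pur has_spectrum_two_blocks by (blast intro: randomness_eq_coherence)
  also have "\<dots> = block_coherence (c * p) (c * q) (c * cmod z)"
    by (simp only: coherence_two_blocks norm_z norm_zero block_coherence_0 add_0_right)
  also have "\<dots> = c * block_coherence p q (cmod z)"
    using c assms by (intro block_coherence_scale) auto
  finally have "e * randomness pur ?\<sigma> = (e * c) * block_coherence p q (cmod z)"
    by simp
  then show ?thesis
    using False c(2) by (simp add: herm2_scaleR herm2_0 flip: c_def)
qed

lemma coherence_Phi:
  assumes "is_density \<rho>"
  shows "coherence (Phi \<rho>)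
    = block_coherence (Re (\<rho> $ (0,0) $ (0,0))) (Re (\<rho> $ (1,1) $ (1,1))) (cmod (\<rho> $ (0,0) $ (1,1)))
    + block_coherence (Re (\<rho> $ (0,1) $ (0,1))) (Re (\<rho> $ (1,0) $ (1,0))) (cmod (\<rho> $ (0,1) $ (1,0)))"
  by (simp add: Phi_eq_direct_sum density_blocks[OF assms] coherence_two_blocks)

lemma density_diag_nonneg:
  assumes "is_density \<rho>"
  shows "0 \<le> Re (\<rho> $ i $ i)"
proof -
  have "0 \<le> Re (\<Sum>k\<in>UNIV. cnj (axis i 1 $ k) * (\<rho> *v axis i 1) $ k)"
    using assms by (simp add: is_density_def)
  also have "(\<Sum>k\<in>UNIV. cnj (axis i 1 $ k) * (\<rho> *v axis i 1) $ k)
      = (\<Sum>k\<in>UNIV. if k = i then \<rho> $ k $ i else 0)"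
    by (rule sum.cong) (auto simp: axis_def matrix_vector_mult_def if_distrib cong: if_cong)
  finally show ?thesis by simp
qed

text \<open>The bit flip moves the odd sector into the even one, so the same sector computation
  handles both terms.\<close>

lemma secret_randomness_eq_coherence_Phi:
  assumes pur: "\<And>\<rho>. is_density \<rho> \<Longrightarrow> purifies (pur \<rho>) \<rho>"
    and rho: "is_density \<rho>"
    and eb: "eb = Re (\<rho> $ (0,1) $ (0,1)) + Re (\<rho> $ (1,0) $ (1,0))"
  shows "secret_randomness pur eb \<rho> = coherence (Phi \<rho>)"
proof -
  let ?p = "Re (\<rho> $ (0,0) $ (0,0))" and ?q = "Re (\<rho> $ (1,1) $ (1,1))" and ?z = "\<rho> $ (0,0) $ (1,1)"
  let ?r = "Re (\<rho> $ (0,1) $ (0,1))" and ?u = "Re (\<rho> $ (1,0) $ (1,0))" and ?w = "\<rho> $ (0,1) $ (1,0)"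
  have "Re (trace \<rho>) = 1" using rho by (simp add: is_density_def)
  then have eb': "1 - eb = ?p + ?q" by (simp add: trace_def sum_bit_pair eb)
  have plus: "post_state Pi_plus \<rho> = direct_sum ((1 / (1 - eb)) *\<^sub>R herm2 ?p ?q ?z) 0"
    by (simp add: post_state_def trace_Pi_plus Pi_plus_conj eb' direct_sum_scaleR density_blocks[OF rho])
  have minus: "post_state Pi_minus \<rho> = direct_sum 0 ((1 / eb) *\<^sub>R herm2 ?r ?u ?w)"
    by (simp add: post_state_def trace_Pi_minus Pi_minus_conj eb direct_sum_scaleR density_blocks[OF rho])
  have "(if 1 - eb = 0 then 0 else (1 - eb) * randomness pur (post_state Pi_plus \<rho>))
      = block_coherence ?p ?q (cmod ?z)"
    unfolding plus
    using density_minor_nonneg[OF rho, of "(0,0)" "(1,1)"]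
    by (intro weighted_randomness_sector[OF pur] density_diag_nonneg[OF rho] eb') auto
  moreover have "(if eb = 0 then 0
      else eb * randomness pur (bit_flip_B ** post_state Pi_minus \<rho> ** bit_flip_B))
      = block_coherence ?r ?u (cmod ?w)"
    unfolding minus bit_flip_conj
    using density_minor_nonneg[OF rho, of "(0,1)" "(1,0)"]
    by (intro weighted_randomness_sector[OF pur] density_diag_nonneg[OF rho] eb) auto
  ultimately show ?thesis by (simp only: secret_randomness_def coherence_Phi[OF rho])
qed

section \<open>Feasible pairs and the states they represent\<close>

lemma coherence_rho_ab:
  "coherence (rho_ab m00 m11 m22 m33 a b)
     = block_coherence m00 m33 \<bar>a\<bar> + block_coherence m11 m22 \<bar>b\<bar>"
  by (simp add: rho_ab_eq_direct_sum coherence_two_blocks)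

lemma Phi_rho_ab: "Phi (rho_ab m00 m11 m22 m33 a b) = rho_ab m00 m11 m22 m33 a b"
  by (simp add: Phi_eq_direct_sum rho_ab_eq_direct_sum even_block_direct_sum odd_block_direct_sum)

lemma square_le_of_abs_le_sqrt: "\<bar>x\<bar> \<le> sqrt y \<Longrightarrow> 0 \<le> y \<Longrightarrow> x\<^sup>2 \<le> y"
  by (metis abs_ge_zero power2_abs power_mono real_sqrt_pow2)

lemma rho_ab_in_bb84_states:
  assumes nonneg: "m00 \<ge> 0" "m11 \<ge> 0" "m22 \<ge> 0" "m33 \<ge> 0" and "m00 + m11 + m22 + m33 = 1"
    and "a + b = 1 / 2 - ep" "\<bar>a\<bar> \<le> sqrt (m00 * m33)" "\<bar>b\<bar> \<le> sqrt (m11 * m22)"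
  shows "rho_ab m00 m11 m22 m33 a b \<in> bb84_states m00 m11 m22 m33 ep"
proof -
  let ?\<rho> = "rho_ab m00 m11 m22 m33 a b"
  have dens: "is_density ?\<rho>"
    unfolding rho_ab_eq_direct_sum
    using assms by (intro is_density_two_blocks) (auto intro: square_le_of_abs_le_sqrt)
  have entries: "?\<rho> $ (0, 0) $ (0, 0) = of_real m00" "?\<rho> $ (0, 1) $ (0, 1) = of_real m11"
    "?\<rho> $ (1, 0) $ (1, 0) = of_real m22" "?\<rho> $ (1, 1) $ (1, 1) = of_real m33"
    "?\<rho> $ (0, 0) $ (1, 1) = of_real a" "?\<rho> $ (1, 1) $ (0, 0) = of_real a"
    "?\<rho> $ (0, 1) $ (1, 0) = of_real b" "?\<rho> $ (1, 0) $ (0, 1) = of_real b"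
    by (simp_all add: rho_ab_eq_direct_sum direct_sum_def herm2_def)
  have "trace (Pi_x_minus ** ?\<rho>) = of_real ((1 - 2 * (a + b)) / 2)"
    using dens by (simp add: trace_Pi_x_minus entries is_density_def)
  also have "(1 - 2 * (a + b)) / 2 = ep" using assms(6) by simp
  finally show ?thesis using dens entries by (simp add: bb84_states_def)
qed

text \<open>The pair is formed by the real parts of the two antidiagonal entries: Hermiticity lets
  only these enter the phase error rate, and their absolute values do not exceed the moduli.\<close>

lemma bb84_coherence_Phi_ge:
  assumes rho: "\<rho> \<in> bb84_states m00 m11 m22 m33 ep"
  obtains a b where "a + b = 1 / 2 - ep" "\<bar>a\<bar> \<le> sqrt (m00 * m33)" "\<bar>b\<bar> \<le> sqrt (m11 * m22)"
    "coherence (rho_ab m00 m11 m22 m33 a b) \<le> coherence (Phi \<rho>)"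
proof -
  have dens: "is_density \<rho>" and trace_x: "trace (Pi_x_minus ** \<rho>) = of_real ep"
    and diag: "Re (\<rho> $ (0, 0) $ (0, 0)) = m00" "Re (\<rho> $ (0, 1) $ (0, 1)) = m11"
    "Re (\<rho> $ (1, 0) $ (1, 0)) = m22" "Re (\<rho> $ (1, 1) $ (1, 1)) = m33"
    using rho by (auto simp: bb84_states_def)
  define z w where "z = \<rho> $ (0,0) $ (1,1)" and "w = \<rho> $ (0,1) $ (1,0)"
  have nonneg: "m00 \<ge> 0" "m11 \<ge> 0" "m22 \<ge> 0" "m33 \<ge> 0"
    using density_diag_nonneg[OF dens] diag by metis+
  have z: "(cmod z)\<^sup>2 \<le> m00 * m33" and w: "(cmod w)\<^sup>2 \<le> m11 * m22"
    using density_minor_nonneg[OF dens, of "(0,0)" "(1,1)"] density_minor_nonneg[OF dens, of "(0,1)" "(1,0)"]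
    by (simp_all add: z_def w_def diag)
  have cnj: "\<rho> $ (1,1) $ (0,0) = cnj z" "\<rho> $ (1,0) $ (0,1) = cnj w"
    using density_hermitian[OF dens, of "(0,0)" "(1,1)"] density_hermitian[OF dens, of "(0,1)" "(1,0)"]
    by (simp_all add: z_def w_def)
  have "Re (trace (Pi_x_minus ** \<rho>)) = (1 - 2 * Re z - 2 * Re w) / 2"
    using dens by (simp add: trace_Pi_x_minus is_density_def cnj flip: z_def w_def)
  then have "Re z + Re w = 1 / 2 - ep" using trace_x by simp
  moreover have "\<bar>Re z\<bar> \<le> sqrt (m00 * m33)" "\<bar>Re w\<bar> \<le> sqrt (m11 * m22)"
    using abs_Re_le_cmod[of z] abs_Re_le_cmod[of w] real_le_rsqrt[OF z] real_le_rsqrt[OF w] by linarith+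
  moreover have "coherence (rho_ab m00 m11 m22 m33 (Re z) (Re w)) \<le> coherence (Phi \<rho>)"
    unfolding coherence_rho_ab coherence_Phi[OF dens] diag z_def[symmetric] w_def[symmetric]
    using nonneg z w by (intro add_mono block_coherence_mono abs_Re_le_cmod) auto
  ultimately show ?thesis using that by blast
qed

lemma min_over_eq:
  assumes "x \<in> S" and "\<And>y. y \<in> S \<Longrightarrow> f x \<le> f y"
  shows "min_over f S = f x"
  unfolding min_over_def by (rule Least_equality) (use assms in auto)

theorem theorem2:
  fixes m00 m11 m22 m33 ep eb abar bbar :: real
    and S :: "two_qubit_op set"
    and pur :: "two_qubit_op \<Rightarrow> ((2 \<times> 2) \<times> 'e::finite) ket"
  assumes "m00 \<ge> 0" "m11 \<ge> 0" "m22 \<ge> 0" "m33 \<ge> 0"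
    and "m00 + m11 + m22 + m33 = 1"
    and "0 \<le> ep" "ep \<le> 1"
    and "eb = m11 + m22"
    and "S = bb84_states m00 m11 m22 m33 ep"
    and "S \<noteq> {}"
    and "\<And>\<rho>. is_density \<rho> \<Longrightarrow> purifies (pur \<rho>) \<rho>"
    and "is_arg_min (\<lambda>(a, b). coherence (rho_ab m00 m11 m22 m33 a b))
           (\<lambda>(a, b). a + b = 1 / 2 - ep \<and> \<bar>a\<bar> \<le> sqrt (m00 * m33) \<and> \<bar>b\<bar> \<le> sqrt (m11 * m22))
           (abar, bbar)"
  shows "(\<exists>\<rho>. is_arg_min (secret_randomness pur eb) (\<lambda>\<rho>. \<rho> \<in> S) \<rho>)
    \<and> (\<exists>\<rho>. is_arg_min (\<lambda>\<rho>. coherence (Phi \<rho>)) (\<lambda>\<rho>. \<rho> \<in> S) \<rho>)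
    \<and> key_rate pur eb S = min_over (\<lambda>\<rho>. coherence (Phi \<rho>)) S - binary_entropy eb
    \<and> min_over (\<lambda>\<rho>. coherence (Phi \<rho>)) S - binary_entropy eb
        = coherence (rho_ab m00 m11 m22 m33 abar bbar) - binary_entropy eb"
proof -
  let ?\<rho>\<^sub>0 = "rho_ab m00 m11 m22 m33 abar bbar"
  have feas: "abar + bbar = 1 / 2 - ep" "\<bar>abar\<bar> \<le> sqrt (m00 * m33)" "\<bar>bbar\<bar> \<le> sqrt (m11 * m22)"
    and opt: "\<And>a b. a + b = 1 / 2 - ep \<Longrightarrow> \<bar>a\<bar> \<le> sqrt (m00 * m33) \<Longrightarrow> \<bar>b\<bar> \<le> sqrt (m11 * m22)
      \<Longrightarrow> coherence ?\<rho>\<^sub>0 \<le> coherence (rho_ab m00 m11 m22 m33 a b)"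
    using assms(12) by (auto simp: is_arg_min_linorder)
  have mem: "?\<rho>\<^sub>0 \<in> S"
    unfolding assms(9) by (rule rho_ab_in_bb84_states) (use assms(1-5) feas in auto)
  \<comment> \<open>\<open>Phi\<close> fixes the candidate, so optimality over pairs
    \<open>(a, b)\<close> transfers to all of \<open>S\<close>: each state is bounded below by some
    feasible pair.\<close>
  have min: "coherence (Phi ?\<rho>\<^sub>0) \<le> coherence (Phi \<rho>)" if "\<rho> \<in> S" for \<rho>
    using that opt unfolding assms(9) Phi_rho_ab by (meson bb84_coherence_Phi_ge order_trans)
  have eq: "secret_randomness pur eb \<rho> = coherence (Phi \<rho>)" if "\<rho> \<in> S" for \<rho>
    using that assms(8,9,11)
    by (intro secret_randomness_eq_coherence_Phi) (auto simp: bb84_states_def)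
  have min': "secret_randomness pur eb ?\<rho>\<^sub>0 \<le> secret_randomness pur eb \<rho>" if "\<rho> \<in> S" for \<rho>
    using min[OF that] eq[OF that] eq[OF mem] by simp
  have "min_over (secret_randomness pur eb) S = coherence (Phi ?\<rho>\<^sub>0)"
    using min_over_eq[of ?\<rho>\<^sub>0 S "secret_randomness pur eb", OF mem min'] eq[OF mem] by simp
  moreover have "min_over (\<lambda>\<rho>. coherence (Phi \<rho>)) S = coherence (Phi ?\<rho>\<^sub>0)"
    using min_over_eq[of ?\<rho>\<^sub>0 S "\<lambda>\<rho>. coherence (Phi \<rho>)", OF mem min] .
  ultimately show ?thesis
    using mem min min' by (auto simp: is_arg_min_linorder key_rate_def Phi_rho_ab)
qed

end
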